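(* If $f=h+\overline{g}\in\mathcal{E}_H$, then $f$ is (extends to) a harmonic entire mapping of exponential type, and for every $r>0$ we have $$M(r,f)\le\frac{e^{2\gamma r}-1}{\gamma},$$ where $\gamma=\max\{\alpha_0,\beta_0\}$, $\alpha_0=\sup\{|a_2|: f\in\mathcal{E}_H\}$ and $\beta_0=\sup\{|b_2|: f\in\mathcal{E}_H\}$.
   Context: Let $\mathbb{D}=\{z\in\mathbb{C}:|z|<1\}$. A harmonic mapping $f=h+\overline{g}$ ($h,g$ analytic) is sense-preserving if $g'=\omega h'$ for some analytic $\omega$ with $|\omega|<1$ and $f$ is nonconstant. $\mathcal{S}_H$ is the class of all univalent (injective) sense-preserving harmonic mappings $f=h+\overline{g}$ in $\mathbb{D}$ with $h(z)=z+\sum_{n=2}^{\infty}a_nz^n$ and $g(z)=\sum_{n=1}^{\infty}b_nz^n$. For $n\ge 0$ write $f^{(n)}:=h^{(n)}+\overline{g^{(n)}}$. $\mathcal{E}_H$ is the family of $f\in\mathcal{S}_H$ such that for each $n\ge1$ the mapping $f^{(n)}$ is also univalent in $\mathbb{D}$. In the definitions of $\alpha_0,\beta_0$, $a_2$ and $b_2$ are the second coefficients of $h$ and $g$ for $f=h+\overline{g}$; both suprema are finite. A harmonic entire mapping is a complex-valued harmonic function on $\mathbb{C}$. $M(r,f)=\max_{|z|=r}|f(z)|$. The order of $f$ is $\limsup_{r\to\infty}\frac{\log\log M(r,f)}{\log r}$, and for order $\rho\in(0,\infty)$ the type is $\limsup_{r\to\infty}\frac{\log M(r,f)}{r^\rho}$.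 A harmonic entire mapping is of exponential type if, for some $\tau<\infty$, either its order is less than $1$, or its order is $1$ and its type is at most $\tau$. *)

theory Defs
  imports "HOL-Complex_Analysis.Complex_Analysis"
begin

abbreviation unit_disc :: "complex set" where
  "unit_disc \<equiv> ball 0 1"

definition taylor_coeff :: "(complex \<Rightarrow> complex) \<Rightarrow> nat \<Rightarrow> complex" where
  "taylor_coeff h n = (deriv ^^ n) h 0 / fact n"

definition harmonic_map :: "(complex \<Rightarrow> complex) \<Rightarrow> (complex \<Rightarrow> complex) \<Rightarrow> complex \<Rightarrow> complex" where
  "harmonic_map h g z = h z + cnj (g z)"

definition sense_preserving :: "(complex \<Rightarrow> complex) \<Rightarrow> (complex \<Rightarrow> complex) \<Rightarrow> bool" where
  "sense_preserving h g \<longleftrightarrow>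
     (\<exists>\<omega>. \<omega> holomorphic_on unit_disc \<and>
          (\<forall>z\<in>unit_disc. norm (\<omega> z) < 1 \<and> deriv g z = \<omega> z * deriv h z)) \<and>
     \<not> harmonic_map h g constant_on unit_disc"

(* A mapping f = h + cnj g is represented by the pair (h, g). The normalisation g 0 = 0
   makes h and g on the disc unique for a given f; their values off the disc are irrelevant. *)
definition S_H :: "((complex \<Rightarrow> complex) \<times> (complex \<Rightarrow> complex)) set" where
  "S_H = {(h, g). h holomorphic_on unit_disc \<and> g holomorphic_on unit_disc \<and>
            taylor_coeff h 0 = 0 \<and> taylor_coeff h 1 = 1 \<and> taylor_coeff g 0 = 0 \<and>
            sense_preserving h g \<and> inj_on (harmonic_map h g) unit_disc}"

definition E_H :: "((complex \<Rightarrow> complex) \<times> (complex \<Rightarrow> complex)) set" where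
  "E_H = {(h, g). (h, g) \<in> S_H \<and>
            (\<forall>n\<ge>1. inj_on (harmonic_map ((deriv ^^ n) h) ((deriv ^^ n) g)) unit_disc)}"

(* Suprema in the reals; both sets are nonempty and bounded above. *)
definition alpha0 :: real where
  "alpha0 = (SUP (h, g)\<in>E_H. norm (taylor_coeff h 2))"

definition beta0 :: real where
  "beta0 = (SUP (h, g)\<in>E_H. norm (taylor_coeff g 2))"

(* C^2 with vanishing Laplacian: fx, fy are the first partial derivatives and
   fxx, fxy, fyx, fyy the (continuous) second ones, with z = x + i y. *)
definition harmonic_on :: "(complex \<Rightarrow> complex) \<Rightarrow> complex set \<Rightarrow> bool" where
  "harmonic_on f S \<longleftrightarrow> open S \<and>
     (\<exists>fx fy fxx fxy fyx fyy.
        (\<forall>z\<in>S. (f has_derivative (\<lambda>w. Re w *\<^sub>R fx z + Im w *\<^sub>R fy z)) (at z)) \<and>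
        (\<forall>z\<in>S. (fx has_derivative (\<lambda>w. Re w *\<^sub>R fxx z + Im w *\<^sub>R fxy z)) (at z)) \<and>
        (\<forall>z\<in>S. (fy has_derivative (\<lambda>w. Re w *\<^sub>R fyx z + Im w *\<^sub>R fyy z)) (at z)) \<and>
        continuous_on S fxx \<and> continuous_on S fxy \<and>
        continuous_on S fyx \<and> continuous_on S fyy \<and>
        (\<forall>z\<in>S. fxx z + fyy z = (0 :: complex)))"

definition harmonic_entire :: "(complex \<Rightarrow> complex) \<Rightarrow> bool" where
  "harmonic_entire f \<longleftrightarrow> harmonic_on f UNIV"

(* For continuous f and r \<ge> 0 the supremum is attained (sphere 0 r is compact). *)
definition max_modulus :: "real \<Rightarrow> (complex \<Rightarrow> complex) \<Rightarrow> real" where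
  "max_modulus r f = (SUP z\<in>sphere 0 r. norm (f z))"

definition growth_order :: "(complex \<Rightarrow> complex) \<Rightarrow> ereal" where
  "growth_order f = Limsup at_top (\<lambda>r. ereal (ln (ln (max_modulus r f)) / ln r))"

(* Only meaningful when growth_order f is positive and finite. *)
definition growth_type :: "(complex \<Rightarrow> complex) \<Rightarrow> ereal" where
  "growth_type f =
     Limsup at_top (\<lambda>r. ereal (ln (max_modulus r f) / r powr real_of_ereal (growth_order f)))"

definition exponential_type :: "(complex \<Rightarrow> complex) \<Rightarrow> bool" where
  "exponential_type f \<longleftrightarrow>
     (\<exists>\<tau>::real. growth_order f < 1 \<or> (growth_order f = 1 \<and> growth_type f \<le> ereal \<tau>))"

end

theory Submission
  imports Defs
begin

text \<open>
  By Lewy's theorem every derivative \<open>f\<^sup>(\<^sup>n\<^sup>)\<close> has a Jacobian of constant sign, so after an affine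
  normalisation (and complex conjugation, if it reverses the orientation) it is again a member of
  the class. Hence \<open>max |h\<^sup>(\<^sup>n\<^sup>+\<^sup>1\<^sup>)(0)| |g\<^sup>(\<^sup>n\<^sup>+\<^sup>1\<^sup>)(0)|\<close> is at most \<open>2 * \<gamma>\<close> times the same quantity for \<open>n\<close>,
  and summing the Taylor series gives the bound. This needs the two suprema to be finite, which is
  shown without the compactness of the class of univalent harmonic mappings: \<open>f'\<close> is univalent and,
  because \<open>f\<close> preserves the orientation, omits 0; so \<open>log f'\<close> never takes two values
  differing by \<open>2 * pi * i\<close>, which would fail if the second coefficient were large. The growth order
  requires \<open>M(r,f) \<ge> e\<close> for large \<open>r\<close>, which follows from Liouville's theorem for
  \<open>exp (h + g)\<close> and \<open>exp (- i * (h - g))\<close>.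
\<close>

section \<open>Lewy's theorem\<close>

text \<open>At the end of each arm \<open>v\<close> lies above or below \<open>v 0\<close>. Two of
  the three or more arms agree in this, and by the intermediate value theorem they share a value
  other than \<open>v 0\<close>.\<close>

lemma no_injective_real_star:
  fixes v :: "complex \<Rightarrow> real" and D :: "complex set"
  assumes "\<epsilon> > 0" and D: "D \<subseteq> sphere 0 1" "card D \<ge> 3"
    and cont: "continuous_on (cball 0 \<epsilon>) v"
    and inj: "inj_on v {of_real t * d |t d. 0 \<le> t \<and> t \<le> \<epsilon> \<and> d \<in> D}"
  shows False
proof -
  define T where "T = {of_real t * d |t d. 0 \<le> t \<and> t \<le> \<epsilon> \<and> d \<in> D}"
  define s where "s = (\<lambda>d. v (of_real \<epsilon> * d) > v 0)"
  have "card (s ` D) \<le> card (UNIV :: bool set)" by (intro card_mono) auto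
  then have "card (s ` D) < card D" using D(2) by simp
  then have "\<not> inj_on s D" by (rule pigeonhole)
  then obtain d e where de: "d \<in> D" "e \<in> D" "d \<noteq> e" "s d = s e" by (auto simp: inj_on_def)
  have cray: "continuous_on {0..\<epsilon>} (\<lambda>t. v (of_real t * d))" if "d \<in> D" for d
    by (rule continuous_on_compose2[OF cont]) (use D(1) that in \<open>auto intro!: continuous_intros simp: norm_mult\<close>)
  have zT: "of_real t * d \<in> T" if "0 \<le> t" "t \<le> \<epsilon>" "d \<in> D" for t d
    using that unfolding T_def by blast
  have norm1: "norm d = 1" if "d \<in> D" for d using that D(1) by auto
  have ne: "v (of_real \<epsilon> * d) \<noteq> v 0" if "d \<in> D" for d
  proof
    assume "v (of_real \<epsilon> * d) = v 0"
    moreover have "0 \<in> T" using zT[of 0 d] \<open>\<epsilon> > 0\<close> that by simp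
    moreover have "of_real \<epsilon> * d \<in> T" using zT \<open>\<epsilon> > 0\<close> that by simp
    ultimately have "of_real \<epsilon> * d = 0"
      using inj unfolding T_def[symmetric] inj_on_def by blast
    then show False using norm1[OF that] \<open>\<epsilon> > 0\<close> by auto
  qed
  \<comment> \<open>The endpoint value closer to \<open>v 0\<close> lies between \<open>v 0\<close>
    and both endpoint values.\<close>
  obtain y where y: "y \<noteq> v 0" "\<And>c. c \<in> {d, e} \<Longrightarrow> y \<in> closed_segment (v 0) (v (of_real \<epsilon> * c))"
  proof (cases "s d")
    case True
    then have "s d" "s e" using de by auto
    then show ?thesis
      by (intro that[of "min (v (of_real \<epsilon> * d)) (v (of_real \<epsilon> * e))"])
         (auto simp: s_def closed_segment_eq_real_ivl)
  next
    case False
    then have "\<not> s d" "\<not> s e" using de by auto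
    then show ?thesis using ne[OF de(1)] ne[OF de(2)]
      by (intro that[of "max (v (of_real \<epsilon> * d)) (v (of_real \<epsilon> * e))"])
         (auto simp: s_def closed_segment_eq_real_ivl)
  qed
  have hit: "\<exists>t. 0 < t \<and> t \<le> \<epsilon> \<and> v (of_real t * c) = y" if "c \<in> {d, e}" for c
  proof -
    have "\<exists>t\<in>{0..\<epsilon>}. v (of_real t * c) = y"
    proof -
      have "connected ((\<lambda>t. v (of_real t * c)) ` {0..\<epsilon>})"
        using cray that de by (intro connected_continuous_image) auto
      then have "convex ((\<lambda>t. v (of_real t * c)) ` {0..\<epsilon>})"
        using is_interval_connected_1 is_interval_convex_1 by blast
      then have "closed_segment (v (of_real 0 * c)) (v (of_real \<epsilon> * c)) \<subseteq> (\<lambda>t. v (of_real t * c)) ` {0..\<epsilon>}"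
        using \<open>\<epsilon> > 0\<close> by (intro closed_segment_subset imageI) auto
      then show ?thesis using y(2)[OF that] by auto
    qed
    then obtain t where t: "t \<in> {0..\<epsilon>}" "v (of_real t * c) = y" by blast
    have "t \<noteq> 0" using y(1) t(2) by auto
    then show ?thesis using t by (intro exI[of _ t]) auto
  qed
  obtain t1 where t1: "0 < t1" "t1 \<le> \<epsilon>" "v (of_real t1 * d) = y" using hit by blast
  obtain t2 where t2: "0 < t2" "t2 \<le> \<epsilon>" "v (of_real t2 * e) = y" using hit by blast
  have eq: "of_real t1 * d = of_real t2 * e"
  proof -
    have "of_real t1 * d \<in> T" "of_real t2 * e \<in> T" using zT t1 t2 de by simp_all
    moreover have "v (of_real t1 * d) = v (of_real t2 * e)" using t1 t2 by simp
    ultimately show ?thesis using inj unfolding T_def[symmetric] inj_on_def by blast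
  qed
  then have "norm (of_real t1 * d) = norm (of_real t2 * e)" by simp
  then have "t1 = t2" using norm1 de t1 t2 by (simp add: norm_mult)
  then show False using eq t1 de by simp
qed

text \<open>The zero of \<open>f - f z\<close> at \<open>z\<close> has a finite order
  \<open>m\<close>, so \<open>f - f z\<close> is locally the \<open>m\<close>-th power of a map
  \<open>\<phi>\<close> with nonzero derivative at \<open>z\<close>. The coordinate
  \<open>\<psi>\<close> is the local inverse of \<open>\<phi>\<close>.\<close>

lemma power_normal_form:
  assumes holf: "f holomorphic_on S" and S: "open S" "connected S" "z \<in> S"
    and nc: "\<not> f constant_on S" and d0: "deriv f z = 0"
  obtains m \<epsilon> \<psi> where "m \<ge> 2" "\<epsilon> > 0" "continuous_on (cball 0 \<epsilon>) \<psi>" "inj_on \<psi> (cball 0 \<epsilon>)"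
    "\<psi> ` cball 0 \<epsilon> \<subseteq> S" "\<And>\<zeta>. \<zeta> \<in> cball 0 \<epsilon> \<Longrightarrow> f (\<psi> \<zeta>) = f z + \<zeta> ^ m"
proof -
  have "\<exists>n>0. (deriv ^^ n) f z \<noteq> 0"
  proof (rule ccontr)
    assume "\<not> ?thesis"
    then have "f w = f z" if "w \<in> S" for w
      using holomorphic_fun_eq_const_on_connected[OF holf S(1,2) _ S(3) that] by blast
    then show False using nc unfolding constant_on_def by blast
  qed
  then obtain m where m: "m > 0" "(deriv ^^ m) f z \<noteq> 0" "\<And>i. 0 < i \<Longrightarrow> i < m \<Longrightarrow> (deriv ^^ i) f z = 0"
    using exists_least_iff[of "\<lambda>n. n > 0 \<and> (deriv ^^ n) f z \<noteq> 0"] by blast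
  have m2: "m \<ge> 2" using m(1,2) d0 by (cases "m = 1") auto
  obtain g r where gr: "0 < r" "g holomorphic_on ball z r"
      "\<And>w. w \<in> ball z r \<Longrightarrow> f w - f z = ((w - z) * g w) ^ m"
      "\<And>w. w \<in> ball z r \<Longrightarrow> g w \<noteq> 0"
    by (rule holomorphic_factor_order_of_zero_strong[OF holf S(1,3) m]) blast+
  obtain r' where r': "0 < r'" "ball z r' \<subseteq> S" using S open_contains_ball by blast
  define q where "q = min r r'"
  have q: "0 < q" "ball z q \<subseteq> S" "ball z q \<subseteq> ball z r" using gr(1) r' by (auto simp: q_def)
  define \<phi> where "\<phi> = (\<lambda>w. (w - z) * g w)"
  have hol: "\<phi> holomorphic_on ball z q"
    unfolding \<phi>_def using holomorphic_on_subset[OF gr(2) q(3)] by (intro holomorphic_intros)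
  have "(\<phi> has_field_derivative g z) (at z)"
  proof -
    have "(g has_field_derivative deriv g z) (at z)"
      using gr(1,2) by (intro holomorphic_derivI[of g "ball z r"]) auto
    then show ?thesis unfolding \<phi>_def by (auto intro!: derivative_eq_intros)
  qed
  then have "deriv \<phi> z = g z" by (rule DERIV_imp_deriv)
  then have dnz: "deriv \<phi> z \<noteq> 0" using gr(4)[of z] gr(1) by simp
  obtain s where s: "s > 0" "ball z s \<subseteq> ball z q" "open (\<phi> ` ball z s)" "inj_on \<phi> (ball z s)"
    by (rule has_complex_derivative_locally_invertible[OF hol _ open_ball dnz]) (use q(1) in auto)
  have hols: "\<phi> holomorphic_on ball z s" using hol s(2) holomorphic_on_subset by blast
  obtain \<psi> where \<psi>: "\<psi> holomorphic_on \<phi> ` ball z s" "\<And>w. w \<in> ball z s \<Longrightarrow> \<psi> (\<phi> w) = w"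
    by (rule holomorphic_has_inverse[OF hols open_ball s(4)]) blast
  have "0 \<in> \<phi> ` ball z s" using s(1) by (auto simp: \<phi>_def image_iff intro!: bexI[of _ z])
  then obtain \<epsilon> where e: "\<epsilon> > 0" "cball 0 \<epsilon> \<subseteq> \<phi> ` ball z s"
    using s(3) open_contains_cball by blast
  have ps: "\<psi> \<zeta> \<in> ball z s \<and> \<phi> (\<psi> \<zeta>) = \<zeta>" if \<zeta>: "\<zeta> \<in> cball 0 \<epsilon>" for \<zeta>
  proof -
    obtain w where "w \<in> ball z s" "\<zeta> = \<phi> w" using \<zeta> e(2) by blast
    then show ?thesis using \<psi>(2) by auto
  qed
  show thesis
  proof (rule that[OF m2 e(1)])
    show "continuous_on (cball 0 \<epsilon>) \<psi>"
      using holomorphic_on_imp_continuous_on[OF \<psi>(1)] e(2) continuous_on_subset by blast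
    show "inj_on \<psi> (cball 0 \<epsilon>)" using ps by (metis inj_onI)
    show "\<psi> ` cball 0 \<epsilon> \<subseteq> S" using ps s(2) q(2) by blast
    show "f (\<psi> \<zeta>) = f z + \<zeta> ^ m" if "\<zeta> \<in> cball 0 \<epsilon>" for \<zeta>
    proof -
      have "\<psi> \<zeta> \<in> ball z r" using ps[OF that] s(2) q(3) by blast
      from gr(3)[OF this] show ?thesis using ps[OF that] by (simp add: \<phi>_def algebra_simps)
    qed
  qed
qed

text \<open>Multiplying the equation by \<open>c\<close> turns it into
  \<open>c ^ 2 * a + b = 0\<close>. For Lewy's theorem this selects the \<open>c\<close> for which
  \<open>c * h + cnj c * g\<close> has a critical point.\<close>

lemma unimodular_rotation:
  fixes a b :: complex
  assumes "norm a = norm b"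
  obtains c where "norm c = 1" "c * a + cnj c * b = 0"
proof (cases "a = 0")
  case True
  then show ?thesis using assms that[of 1] by simp
next
  case False
  define c where "c = csqrt (- b / a)"
  have c2: "c ^ 2 = - b / a" by (simp add: c_def)
  have "norm c ^ 2 = 1" unfolding norm_power[symmetric] c2 using assms False by (auto simp: norm_divide)
  then have n: "norm c = 1" using power_eq_imp_eq_base[of "norm c" 2 1] by simp
  have "cnj c * c = 1" using n complex_norm_square[of c] by (simp add: mult.commute)
  moreover have "c * (c * a + cnj c * b) = c ^ 2 * a + (cnj c * c) * b" by (simp add: algebra_simps power2_eq_square)
  ultimately have "c * (c * a + cnj c * b) = 0" using c2 False by simp
  then show ?thesis using n that[of c] by auto
qed

text \<open>
  If the Jacobian vanishes at \<open>z\<close>, some \<open>Re (c * f)\<close> is the real part of an analytic function with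
  a critical point at \<open>z\<close>, so its level set contains at least three arms issuing from \<open>z\<close>. On
  these \<open>f\<close> would be an injection into a line.
\<close>
theorem Lewy_jacobian_nonzero:
  assumes hol: "h holomorphic_on S" "g holomorphic_on S" and S: "open S" "connected S" "z \<in> S"
    and inj: "inj_on (harmonic_map h g) S"
  shows "norm (deriv h z) \<noteq> norm (deriv g z)"
proof
  assume "norm (deriv h z) = norm (deriv g z)"
  then obtain c where c: "norm c = 1" "c * deriv h z + cnj c * deriv g z = 0" by (rule unimodular_rotation)
  define f where "f = (\<lambda>w. c * h w + cnj c * g w)"
  have holf: "f holomorphic_on S" unfolding f_def by (intro holomorphic_intros hol)
  \<comment> \<open>\<open>c * cnj (g w)\<close> and \<open>cnj c * g w\<close> are conjugate, so
    their real parts agree.\<close>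
  have Re_f: "Re (c * harmonic_map h g w) = Re (f w)" for w by (simp add: f_def harmonic_map_def algebra_simps)
  have "(f has_field_derivative c * deriv h z + cnj c * deriv g z) (at z)"
    unfolding f_def using holomorphic_derivI[OF hol(1) S(1,3)] holomorphic_derivI[OF hol(2) S(1,3)]
    by (auto intro!: derivative_eq_intros)
  then have d0: "deriv f z = 0" using c(2) DERIV_imp_deriv by auto
  obtain D :: "complex set" and \<epsilon> and \<psi> :: "complex \<Rightarrow> complex" where star: "D \<subseteq> sphere 0 1" "card D \<ge> 3" "\<epsilon> > 0"
      "continuous_on (cball 0 \<epsilon>) \<psi>" "inj_on \<psi> (cball 0 \<epsilon>)" "\<psi> ` cball 0 \<epsilon> \<subseteq> S"
      "\<And>t d. 0 \<le> t \<Longrightarrow> t \<le> \<epsilon> \<Longrightarrow> d \<in> D \<Longrightarrow> Re (f (\<psi> (of_real t * d))) = Re (f z)"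
  proof (cases "f constant_on S")
    case True
    obtain r where r: "r > 0" "cball z r \<subseteq> S" using S open_contains_cball by blast
    have im: "(\<lambda>\<zeta>. z + \<zeta>) ` cball 0 r \<subseteq> S" using r by (auto simp: dist_norm subset_iff)
    have eqc: "f w = f z" if "w \<in> S" for w using True that S(3) unfolding constant_on_def by auto
    \<comment> \<open>A constant \<open>f\<close> imposes no condition on the directions, so any
      three unit vectors serve as arms.\<close>
    show ?thesis
    proof (rule that[of "{1, - 1, \<i>}" r "\<lambda>\<zeta>. z + \<zeta>"])
      show "Re (f (z + of_real t * d)) = Re (f z)" if "0 \<le> t" "t \<le> r" "d \<in> {1, - 1, \<i>}" for t d
      proof -
        have "of_real t * d \<in> cball 0 r" using that by (auto simp: norm_mult)
        then show ?thesis using eqc[OF subsetD[OF im imageI]] by simp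
      qed
    qed (use r im in \<open>auto intro!: continuous_intros simp: complex_eq_iff\<close>)
  next
    case False
    obtain m \<epsilon> \<psi> where m: "m \<ge> 2" "\<epsilon> > 0" "continuous_on (cball 0 \<epsilon>) \<psi>" "inj_on \<psi> (cball 0 \<epsilon>)"
        "\<psi> ` cball 0 \<epsilon> \<subseteq> S" "\<And>\<zeta>. \<zeta> \<in> cball 0 \<epsilon> \<Longrightarrow> f (\<psi> \<zeta>) = f z + \<zeta> ^ m"
      using power_normal_form[OF holf S False d0] by metis
    \<comment> \<open>If \<open>d ^ (2 * m) = - 1\<close>, then \<open>d ^ m\<close> is
      \<open>\<i>\<close> or \<open>- \<i>\<close>, so \<open>\<zeta> ^ m\<close> is purely
      imaginary along the ray through \<open>d\<close>. There are \<open>2 * m \<ge> 4\<close> such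
      rays.\<close>
    define D :: "complex set" where "D = {d. d ^ (2 * m) = - 1}"
    have "card D = 2 * m" unfolding D_def using m(1) by (intro card_nth_roots) auto
    moreover have nD: "norm d = 1" if "d \<in> D" for d
    proof -
      have "norm d ^ (2 * m) = 1" 
        using that unfolding norm_power[symmetric] D_def by simp
      then show ?thesis using m(1) power_eq_imp_eq_base[of "norm d" "2 * m" 1] by simp
    qed
    moreover have "Re (f (\<psi> (of_real t * d))) = Re (f z)" if "0 \<le> t" "t \<le> \<epsilon>" "d \<in> D" for t d
    proof -
      have "(d ^ m)\<^sup>2 = - 1" using that(3) by (simp add: D_def power_even_eq)
      then have "d ^ m = \<i> \<or> d ^ m = - \<i>" by (metis power2_i power2_eq_iff)
      then have "Re ((of_real t * d) ^ m) = 0" by (auto simp: power_mult_distrib simp flip: of_real_power)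
      moreover have "of_real t * d \<in> cball 0 \<epsilon>" using that nD by (simp add: norm_mult)
      ultimately show ?thesis using m(6) by simp
    qed
    ultimately show ?thesis using m by (intro that[of D \<epsilon> \<psi>]) auto
  qed
  \<comment> \<open>On the arms the real part of
    \<open>c * harmonic_map h g (\<psi> \<zeta>)\<close> is constant, so the imaginary part alone
    must separate the points there.\<close>
  define v where "v = (\<lambda>\<zeta>. Im (c * harmonic_map h g (\<psi> \<zeta>)))"
  have ch: "continuous_on S (harmonic_map h g)"
    unfolding harmonic_map_def[abs_def] by (intro continuous_intros holomorphic_on_imp_continuous_on hol)
  have contv: "continuous_on (cball 0 \<epsilon>) v"
    unfolding v_def by (intro continuous_intros continuous_on_compose2[OF ch star(4,6)])
  have "inj_on v {of_real t * d |t d. 0 \<le> t \<and> t \<le> \<epsilon> \<and> d \<in> D}"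
  proof (rule inj_onI)
    fix x y assume x: "x \<in> {of_real t * d |t d. 0 \<le> t \<and> t \<le> \<epsilon> \<and> d \<in> D}"
      and y: "y \<in> {of_real t * d |t d. 0 \<le> t \<and> t \<le> \<epsilon> \<and> d \<in> D}" and vxy: "v x = v y"
    have xy: "x \<in> cball 0 \<epsilon>" "y \<in> cball 0 \<epsilon>" using x y star(1) by (auto simp: norm_mult)
    have "Re (c * harmonic_map h g (\<psi> x)) = Re (c * harmonic_map h g (\<psi> y))"
      unfolding Re_f using x y star(7) by auto
    then have "c * harmonic_map h g (\<psi> x) = c * harmonic_map h g (\<psi> y)"
      using vxy by (simp add: v_def complex_eq_iff)
    then have "harmonic_map h g (\<psi> x) = harmonic_map h g (\<psi> y)" using c(1) by auto
    then have "\<psi> x = \<psi> y" using inj xy star(6) unfolding inj_on_def by blast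
    then show "x = y" using star(5) xy unfolding inj_on_def by blast
  qed
  then show False using no_injective_real_star[OF star(3,1,2) contv] by blast
qed
section \<open>Finiteness of the suprema\<close>

text \<open>
  Near the maximum point \<open>z0\<close> of \<open>|L'(z)| * (1/2 - |z|)\<close> the function \<open>L + e\<close> is a bounded perturbation
  of an affine map with large slope, as in Bloch's theorem. By Brouwer it then takes the value
  at \<open>z0\<close> shifted by \<open>2 * pi * i\<close>.
\<close>
lemma exp_inj_deriv_bound:
  assumes holL: "L holomorphic_on unit_disc"
    and conte: "continuous_on (ball 0 (1/2)) e"
    and e1: "\<And>z. norm z < 1/2 \<Longrightarrow> norm (e z) \<le> 1"
    and inj: "inj_on (\<lambda>z. exp (L z + e z)) (ball 0 (1/2))"
  shows "norm (deriv L 0) \<le> 640"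
proof (rule ccontr)
  assume big: "\<not> norm (deriv L 0) \<le> 640"
  define \<Phi> where "\<Phi> = (\<lambda>z. norm (deriv L z) * (1/2 - norm z))"
  have sub: "cball 0 (1/2) \<subseteq> unit_disc" by auto
  have hold: "deriv L holomorphic_on unit_disc" using holL by (intro holomorphic_deriv) auto
  have "continuous_on (cball 0 (1/2)) \<Phi>"
    unfolding \<Phi>_def
    by (intro continuous_intros continuous_on_subset[OF holomorphic_on_imp_continuous_on[OF hold] sub])
  then obtain z0 where z0: "z0 \<in> cball 0 (1/2)" "\<And>z. z \<in> cball 0 (1/2) \<Longrightarrow> \<Phi> z \<le> \<Phi> z0"
    using continuous_attains_sup[of "cball 0 (1/2) :: complex set" \<Phi>] by auto
  define K where "K = norm (deriv L z0)"
  define r where "r = (1/2 - norm z0) / 2"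
  \<comment> \<open>This radius makes the Taylor remainder bound
    \<open>(4 * K / r) * \<delta> ^ 2\<close> equal to \<open>K * \<delta> / 2\<close>; the other
    half is left for the perturbation and the shift.\<close>
  define \<delta> where "\<delta> = r / 8"
  \<comment> \<open>\<open>2 * K * r\<close> is \<open>\<Phi> z0\<close>, which is at least
    \<open>\<Phi> 0 = norm (deriv L 0) / 2 > 320\<close>.\<close>
  have Kr: "K * r > 160"
    using z0(2)[of 0] big by (simp add: \<Phi>_def K_def r_def)
  have "r \<ge> 0" using z0(1) by (simp add: r_def)
  moreover have "r \<noteq> 0" using Kr by auto
  ultimately have r0: "r > 0" by simp
  have "K \<ge> 0" by (simp add: K_def)
  moreover have "K \<noteq> 0" using Kr by auto
  ultimately have K0: "K > 0" by simp
  have inball: "norm z < 1/2" if "z \<in> cball z0 r" for z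
  proof -
    have "norm z \<le> norm z0 + dist z0 z" using norm_triangle_ineq[of z0 "z - z0"] by (simp add: dist_norm norm_minus_commute)
    then show ?thesis using that r0 by (simp add: r_def)
  qed
  \<comment> \<open>On this disc the weight \<open>1/2 - norm z\<close> is at least
    \<open>r\<close>, half of its value at \<open>z0\<close>, so the maximality of
    \<open>\<Phi> z0\<close> costs only a factor 2.\<close>
  have d2: "norm (deriv L z) \<le> 2 * K" if "z \<in> cball z0 r" for z
  proof -
    have "norm z \<le> norm z0 + dist z0 z" using norm_triangle_ineq[of z0 "z - z0"] by (simp add: dist_norm norm_minus_commute)
    then have "r \<le> 1/2 - norm z" using that by (simp add: r_def)
    then have "norm (deriv L z) * r \<le> \<Phi> z" unfolding \<Phi>_def by (intro mult_left_mono) auto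
    also have "\<dots> \<le> \<Phi> z0" using inball[OF that] by (intro z0(2)) auto
    also have "\<dots> = (2 * K) * r" by (simp add: \<Phi>_def K_def r_def)
    finally show ?thesis using r0 by simp
  qed
  have dd: "norm ((deriv ^^ Suc 1) L z) \<le> 4 * K / r" if "z \<in> cball z0 (r/2)" for z
  proof -
    have s: "cball z (r/2) \<subseteq> cball z0 r"
    proof
      fix x assume "x \<in> cball z (r/2)"
      then show "x \<in> cball z0 r" using that dist_triangle[of z0 x z] by simp
    qed
    have s2: "cball z (r/2) \<subseteq> unit_disc" using s inball by force
    have "norm ((deriv ^^ 1) (deriv L) z) \<le> fact 1 * (2 * K) / (r/2) ^ 1"
    proof (rule Cauchy_inequality)
      show "deriv L holomorphic_on ball z (r/2)"
        using s2 by (intro holomorphic_on_subset[OF hold]) auto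
      show "continuous_on (cball z (r/2)) (deriv L)"
        using s2 by (intro holomorphic_on_imp_continuous_on holomorphic_on_subset[OF hold]) auto
      show "norm (deriv L x) \<le> 2 * K" if "norm (z - x) = r/2" for x
        using that s by (intro d2) (auto simp: dist_norm)
    qed (use r0 in auto)
    then show ?thesis by (simp add: field_simps)
  qed
  have \<delta>: "0 < \<delta>" "cball z0 \<delta> \<subseteq> cball z0 (r/2)" "cball z0 \<delta> \<subseteq> cball z0 r" using r0 by (auto simp: \<delta>_def)
  have cr: "cball z0 (r/2) \<subseteq> cball z0 r" using r0 by auto
  have taylor: "norm (L z - L z0 - deriv L z0 * (z - z0)) \<le> K * \<delta> / 2" if "z \<in> cball z0 \<delta>" for z
  proof -
    have "norm ((deriv ^^ 0) L z - (\<Sum>i\<le>1. (deriv ^^ i) L z0 * (z - z0) ^ i / fact i))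
       \<le> (4 * K / r) * norm (z - z0) ^ Suc 1 / fact 1"
    proof (rule complex_Taylor[where S = "cball z0 (r/2)" and f = "\<lambda>i. (deriv ^^ i) L"])
      fix i x assume "x \<in> cball z0 (r/2)"
      then have "x \<in> unit_disc" using inball cr by force
      then show "((deriv ^^ i) L has_field_derivative (deriv ^^ Suc i) L x) (at x within cball z0 (r/2))"
        using holL has_field_derivative_higher_deriv[of L unit_disc x i] has_field_derivative_at_within by blast
    qed (use dd \<delta> that r0 in auto)
    also have "norm (z - z0) ^ Suc 1 \<le> \<delta> ^ Suc 1"
      using that by (intro power_mono) (auto simp: dist_norm norm_minus_commute)
    then have "(4 * K / r) * norm (z - z0) ^ Suc 1 / fact 1 \<le> (4 * K / r) * \<delta> ^ Suc 1 / fact 1"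
      using K0 r0 by (intro divide_right_mono mult_left_mono) auto
    also have "\<dots> = K * \<delta> / 2" using r0 by (simp add: \<delta>_def field_simps power2_eq_square)
    finally show ?thesis by (simp add: algebra_simps)
  qed
  define A where "A = (\<lambda>z. L z + e z)"
  define w where "w = A z0 + 2 * of_real pi * \<i>"
  \<comment> \<open>A Newton step with frozen derivative: the fixed points of \<open>G\<close> are
    the solutions of \<open>A z = w\<close>. Brouwer's theorem applies although \<open>e\<close> is
    only continuous.\<close>
  define G where "G = (\<lambda>z. z + (w - A z) / deriv L z0)"
  have nz: "deriv L z0 \<noteq> 0" using K0 by (auto simp: K_def)
  have sb: "cball z0 \<delta> \<subseteq> ball 0 (1/2)" using \<delta>(3) inball by force
  have contG: "continuous_on (cball z0 \<delta>) G"
  proof -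
    have "continuous_on (cball z0 \<delta>) L" using sb by (intro holomorphic_on_imp_continuous_on holomorphic_on_subset[OF holL]) force
    then show ?thesis unfolding G_def A_def using nz
      by (intro continuous_intros continuous_on_subset[OF conte sb]) auto
  qed
  have "G z \<in> cball z0 \<delta>" if z: "z \<in> cball z0 \<delta>" for z
  proof -
    have "(G z - z0) * deriv L z0 = 2 * of_real pi * \<i> - (L z - L z0 - deriv L z0 * (z - z0)) - e z + e z0"
      using nz by (simp add: G_def w_def A_def field_simps)
    then have "norm (G z - z0) * K = norm (2 * of_real pi * \<i> - (L z - L z0 - deriv L z0 * (z - z0)) - e z + e z0)"
      unfolding K_def by (metis norm_mult)
    also have "\<dots> \<le> norm (2 * of_real pi * \<i>) + norm (L z - L z0 - deriv L z0 * (z - z0)) + norm (e z) + norm (e z0)"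
      by norm
    also have "\<dots> \<le> 2 * pi + K * \<delta> / 2 + 1 + 1"
      using taylor[OF z] e1[of z] e1[of z0] inball[of z0] sb z r0 by (intro add_mono) (auto simp: norm_mult)
    \<comment> \<open>\<open>2 * pi + 2 < 10\<close>, while \<open>K * \<delta> / 2 > 10\<close>
      because \<open>K * r > 160\<close>.\<close>
    also have "\<dots> \<le> K * \<delta>" using Kr pi_less_4 by (simp add: \<delta>_def)
    finally have "norm (G z - z0) \<le> \<delta>" using K0 by (simp add: mult.commute)
    then show ?thesis by (simp add: dist_norm norm_minus_commute)
  qed
  then obtain z where z: "z \<in> cball z0 \<delta>" "G z = z"
    using brouwer[of "cball z0 \<delta>" G] contG \<delta>(1) by auto
  have Az: "A z = w" using z(2) nz by (simp add: G_def)
  have "exp (L z + e z) = exp (L z0 + e z0)"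
    using Az unfolding w_def A_def by (simp add: exp_add)
  then have "z = z0" using inj z(1) sb \<delta>(1) unfolding inj_on_def by (metis centre_in_cball less_imp_le subsetD)
  then show False using Az by (simp add: w_def)
qed

text \<open>As \<open>p\<close> has no zero, \<open>p = exp L\<close>, and
  \<open>p + cnj q = exp (L + e)\<close> with \<open>e = Ln (1 + cnj q / p)\<close>. The Schwarz
  lemma for \<open>q / p\<close> makes \<open>e\<close> small on the half disc, so
  \<open>exp_inj_deriv_bound\<close> bounds the logarithmic derivative of \<open>p\<close> at 0; it
  also bounds \<open>deriv q 0\<close>.\<close>

lemma normalised_coefficient_bound:
  assumes hol: "p holomorphic_on unit_disc" "q holomorphic_on unit_disc"
    and q0: "q 0 = 0" and less: "\<And>z. z \<in> unit_disc \<Longrightarrow> norm (q z) < norm (p z)"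
    and inj: "inj_on (harmonic_map p q) unit_disc"
  shows "norm (deriv p 0) \<le> 640 * norm (p 0)" "norm (deriv q 0) \<le> norm (p 0)"
proof -
  have pnz: "p z \<noteq> 0" if "z \<in> unit_disc" for z using less[OF that] by auto
  define u where "u = (\<lambda>z. q z / p z)"
  have holu: "u holomorphic_on ball 0 1" unfolding u_def using pnz by (intro holomorphic_intros hol) auto
  have u0: "u 0 = 0" by (simp add: u_def q0)
  have u1: "norm (u z) < 1" if "norm z < 1" for z
    using less[of z] pnz[of z] that by (simp add: u_def norm_divide)
  have uz: "norm (u z) \<le> norm z" if "norm z < 1" for z
    using Schwarz_Lemma(1)[OF holu u0 u1 that] .
  have du: "norm (deriv u 0) \<le> 1" using Schwarz_Lemma(2)[OF holu u0 u1, of 0] by simp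
  have "(q has_field_derivative deriv u 0 * p 0) (at 0)"
  proof (rule has_field_derivative_transform_within_open[where S = unit_disc])
    show "((\<lambda>z. u z * p z) has_field_derivative deriv u 0 * p 0) (at 0)"
      using holomorphic_derivI[OF holu open_ball, of 0] holomorphic_derivI[OF hol(1) open_ball, of 0]
      by (auto intro!: derivative_eq_intros simp: u0)
    show "u z * p z = q z" if "z \<in> unit_disc" for z using pnz[OF that] by (simp add: u_def)
  qed auto
  then have "deriv q 0 = deriv u 0 * p 0" by (rule DERIV_imp_deriv)
  then show "norm (deriv q 0) \<le> norm (p 0)" using du by (simp add: norm_mult mult_left_le_one_le)
  obtain L where L: "L holomorphic_on unit_disc" "\<And>z. z \<in> unit_disc \<Longrightarrow> exp (L z) = p z"
    using holomorphic_logarithm_exists[OF convex_ball open_ball hol(1) pnz, of 0] by auto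
  \<comment> \<open>\<open>x\<close> has the modulus of \<open>u\<close> but is in general not
    analytic; this is why \<open>exp_inj_deriv_bound\<close> asks only for a continuous
    perturbation.\<close>
  define x where "x = (\<lambda>z. cnj (q z) / p z)"
  have nx: "norm (x z) \<le> norm z" if "norm z < 1" for z
    using uz[OF that] by (simp add: x_def u_def norm_divide)
  define e where "e = (\<lambda>z. Ln (1 + x z))"
  have x1: "1 + x z \<notin> \<real>\<^sub>\<le>\<^sub>0" "1 + x z \<noteq> 0" if "norm z < 1/2" for z
  proof -
    have "\<bar>Re (x z)\<bar> < 1" using nx[of z] that abs_Re_le_cmod[of "x z"] by linarith
    then have "Re (1 + x z) > 0" by simp
    then show "1 + x z \<notin> \<real>\<^sub>\<le>\<^sub>0" "1 + x z \<noteq> 0" by (auto simp: complex_nonpos_Reals_iff simp del: plus_complex.sel)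
  qed
  have "norm (deriv L 0) \<le> 640"
  proof (rule exp_inj_deriv_bound[OF L(1)])
    have sb: "ball 0 (1/2) \<subseteq> unit_disc" by auto
    have "continuous_on (ball 0 (1/2)) p" "continuous_on (ball 0 (1/2)) q"
      using holomorphic_on_imp_continuous_on[OF hol(1)] holomorphic_on_imp_continuous_on[OF hol(2)] continuous_on_subset[OF _ sb] by blast+
    then show "continuous_on (ball 0 (1/2)) e"
      unfolding e_def x_def using x1 pnz sb
      by (intro continuous_intros) (auto simp: x_def)
    show "norm (e z) \<le> 1" if "norm z < 1/2" for z
      using norm_Ln_le[of "x z"] nx[of z] that by (simp add: e_def)
    have "harmonic_map p q z = exp (L z + e z)" if "z \<in> ball 0 (1/2)" for z
    proof -
      have "exp (L z) = p z" "p z \<noteq> 0" using that L(2) pnz by auto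
      moreover have "exp (e z) = 1 + x z" using x1[of z] that by (simp add: e_def)
      ultimately show ?thesis by (simp add: exp_add x_def harmonic_map_def field_simps)
    qed
    then show "inj_on (\<lambda>z. exp (L z + e z)) (ball 0 (1/2))"
      using inj_on_subset[OF inj sb] unfolding inj_on_def by metis
  qed
  moreover have "(p has_field_derivative deriv L 0 * p 0) (at 0)"
  proof (rule has_field_derivative_transform_within_open[where S = unit_disc])
    show "((\<lambda>z. exp (L z)) has_field_derivative deriv L 0 * p 0) (at 0)"
      using holomorphic_derivI[OF L(1) open_ball, of 0] L(2)[of 0]
      by (auto intro!: derivative_eq_intros)
  qed (use L(2) in auto)
  then have "deriv p 0 = deriv L 0 * p 0" by (rule DERIV_imp_deriv)
  ultimately show "norm (deriv p 0) \<le> 640 * norm (p 0)" by (simp add: norm_mult mult_right_mono)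
qed

text \<open>The factor \<open>1 - (norm x)\<^sup>2\<close> is positive for
  \<open>norm x < 1\<close>, so the real-linear substitution in \<open>coefficient_bound\<close>
  keeps the strict domination of one component by the other.\<close>

lemma affine_norm_identity:
  fixes a b x :: complex
  shows "(norm (a - cnj x * b))\<^sup>2 - (norm (b - x * a))\<^sup>2 = (1 - (norm x)\<^sup>2) * ((norm a)\<^sup>2 - (norm b)\<^sup>2)"
  unfolding cmod_power2 by (simp add: algebra_simps power2_eq_square)

text \<open>Composing \<open>p + cnj q\<close> with the injective real-linear map
  \<open>\<lambda>w. w - cnj b * cnj w\<close>, where \<open>b = q 0 / p 0\<close>, makes the second
  component vanish at 0 and reduces to the normalised case.\<close>

lemma coefficient_bound:
  assumes hol: "p holomorphic_on unit_disc" "q holomorphic_on unit_disc"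
    and less: "\<And>z. z \<in> unit_disc \<Longrightarrow> norm (q z) < norm (p z)"
    and inj: "inj_on (harmonic_map p q) unit_disc"
  shows "norm (deriv p 0) \<le> 641 * norm (p 0)" "norm (deriv q 0) \<le> 641 * norm (p 0)"
proof -
  define b where "b = q 0 / p 0"
  have l0: "norm (q 0) < norm (p 0)" using less[of 0] by simp
  then have p0: "p 0 \<noteq> 0" by auto
  have b1: "norm b < 1" using l0 p0 by (simp add: b_def norm_divide)
  then have s0: "1 - (norm b)\<^sup>2 > 0" by (simp add: abs_square_less_1)
  \<comment> \<open>The determinant of this real-linear map. It scales both \<open>P 0\<close> and
    the recovered derivatives, hence cancels, and the bound does not degenerate as
    \<open>norm b\<close> approaches 1.\<close>
  define s where "s = 1 - cnj b * b"
  have sn: "s = of_real (1 - (norm b)\<^sup>2)" by (simp add: s_def complex_norm_square mult.commute flip: of_real_power)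
  have "norm s = 1 - (norm b)\<^sup>2" unfolding sn norm_of_real using s0 by simp
  then have ns: "norm s > 0" using s0 by simp
  define P where "P = (\<lambda>z. p z - cnj b * q z)"
  define Q where "Q = (\<lambda>z. q z - b * p z)"
  have P0: "P 0 = s * p 0" using p0 by (simp add: P_def b_def s_def algebra_simps)
  have Pp: "P z + cnj b * Q z = s * p z" "Q z + b * P z = s * q z" for z
    by (simp_all add: P_def Q_def s_def algebra_simps)
  have holPQ: "P holomorphic_on unit_disc" "Q holomorphic_on unit_disc"
    unfolding P_def Q_def by (intro holomorphic_intros hol)+
  have Q0: "Q 0 = 0" using p0 by (simp add: Q_def b_def)
  have lessPQ: "norm (Q z) < norm (P z)" if "z \<in> unit_disc" for z
  proof -
    have "(norm (q z))\<^sup>2 < (norm (p z))\<^sup>2" using less[OF that] by (intro power_strict_mono) auto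
    then have "(norm (P z))\<^sup>2 - (norm (Q z))\<^sup>2 > 0"
      unfolding P_def Q_def affine_norm_identity using s0 by simp
    then show ?thesis using power_less_imp_less_base[of "norm (Q z)" 2 "norm (P z)"] by simp
  qed
  have injPQ: "inj_on (harmonic_map P Q) unit_disc"
  proof (rule inj_onI)
    fix x y assume xy: "x \<in> unit_disc" "y \<in> unit_disc" "harmonic_map P Q x = harmonic_map P Q y"
    have *: "s * harmonic_map p q z = harmonic_map P Q z + cnj b * cnj (harmonic_map P Q z)" for z
    proof -
      have "cnj s = s" by (simp add: s_def mult.commute)
      then have "s * harmonic_map p q z = s * p z + cnj (s * q z)" by (simp add: harmonic_map_def algebra_simps)
      then show ?thesis unfolding Pp[symmetric] by (simp add: harmonic_map_def algebra_simps)
    qed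
    have "s * harmonic_map p q x = s * harmonic_map p q y" unfolding * xy(3) ..
    then have "harmonic_map p q x = harmonic_map p q y" using ns by simp
    then show "x = y" using inj xy unfolding inj_on_def by blast
  qed
  note bnd = normalised_coefficient_bound[OF holPQ Q0 lessPQ injPQ]
  have dp: "(p has_field_derivative deriv p 0) (at 0)" "(q has_field_derivative deriv q 0) (at 0)"
    using holomorphic_derivI[OF hol(1) open_ball, of 0] holomorphic_derivI[OF hol(2) open_ball, of 0] by auto
  have dP: "deriv P 0 = deriv p 0 - cnj b * deriv q 0" "deriv Q 0 = deriv q 0 - b * deriv p 0"
    unfolding P_def Q_def using dp by (auto intro!: DERIV_imp_deriv derivative_eq_intros)
  have "s * deriv p 0 = deriv P 0 + cnj b * deriv Q 0" "s * deriv q 0 = deriv Q 0 + b * deriv P 0"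
    unfolding dP s_def by (simp_all add: algebra_simps)
  moreover have "norm (deriv P 0 + cnj b * deriv Q 0) \<le> norm (deriv P 0) + norm b * norm (deriv Q 0)"
      "norm (deriv Q 0 + b * deriv P 0) \<le> norm (deriv Q 0) + norm b * norm (deriv P 0)"
    by (metis norm_triangle_ineq norm_mult complex_mod_cnj)+
  moreover have "norm b * norm (deriv P 0) \<le> norm (deriv P 0)" "norm b * norm (deriv Q 0) \<le> norm (deriv Q 0)"
    using b1 by (auto intro: mult_left_le_one_le)
  \<comment> \<open>641 is 640 + 1: \<open>deriv P 0\<close> contributes
    \<open>640 * norm (P 0)\<close> and \<open>deriv Q 0\<close> contributes
    \<open>norm (P 0)\<close>.\<close>
  ultimately have "norm s * norm (deriv p 0) \<le> 641 * norm (P 0)" "norm s * norm (deriv q 0) \<le> 641 * norm (P 0)"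
    using bnd unfolding norm_mult[symmetric] by auto
  then show "norm (deriv p 0) \<le> 641 * norm (p 0)" "norm (deriv q 0) \<le> 641 * norm (p 0)"
    using ns unfolding P0 norm_mult by (simp_all add: mult.left_commute)
qed
section \<open>Renormalisation of the derivatives\<close>

text \<open>\<open>E_H\<close> freed of normalisation and orientation. The result is stable under
  differentiation and under conjugation of \<open>f\<close>, which exchanges \<open>h\<close> and
  \<open>g\<close>.\<close>

definition all_univalent :: "(complex \<Rightarrow> complex) \<Rightarrow> (complex \<Rightarrow> complex) \<Rightarrow> bool" where
  "all_univalent h g \<longleftrightarrow> h holomorphic_on unit_disc \<and> g holomorphic_on unit_disc \<and>
     (\<forall>n. inj_on (harmonic_map ((deriv ^^ n) h) ((deriv ^^ n) g)) unit_disc)"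

lemma all_univalent_deriv:
  assumes "all_univalent h g"
  shows "all_univalent (deriv h) (deriv g)"
  unfolding all_univalent_def
proof (intro conjI allI)
  show "deriv h holomorphic_on unit_disc" "deriv g holomorphic_on unit_disc"
    using assms by (auto simp: all_univalent_def intro!: holomorphic_deriv)
  fix n
  show "inj_on (harmonic_map ((deriv ^^ n) (deriv h)) ((deriv ^^ n) (deriv g))) unit_disc"
    using assms unfolding all_univalent_def by (metis funpow_Suc_right comp_apply)
qed

lemma all_univalent_higher_deriv:
  "all_univalent h g \<Longrightarrow> all_univalent ((deriv ^^ n) h) ((deriv ^^ n) g)"
  by (induction n) (auto intro: all_univalent_deriv)

lemma all_univalent_swap:
  assumes "all_univalent h g"
  shows "all_univalent g h"
proof -
  have "inj_on (harmonic_map q p) unit_disc" if "inj_on (harmonic_map p q) unit_disc" for p q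
  proof -
    have "harmonic_map q p = cnj \<circ> harmonic_map p q" by (simp add: fun_eq_iff harmonic_map_def)
    moreover have "inj_on cnj A" for A by (simp add: inj_on_def)
    ultimately show ?thesis using that by (metis comp_inj_on)
  qed
  then show ?thesis using assms unfolding all_univalent_def by blast
qed

text \<open>By Lewy's theorem the difference of the two moduli never vanishes, so it has constant
  sign on the connected disc.\<close>

lemma all_univalent_dichotomy:
  assumes "all_univalent h g"
  shows "(\<forall>z\<in>unit_disc. norm (deriv g z) < norm (deriv h z)) \<or>
         (\<forall>z\<in>unit_disc. norm (deriv h z) < norm (deriv g z))"
proof (rule ccontr)
  define J where "J = (\<lambda>z. norm (deriv h z) - norm (deriv g z))"
  have hol: "h holomorphic_on unit_disc" "g holomorphic_on unit_disc"
    and inj: "inj_on (harmonic_map h g) unit_disc"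
    using assms unfolding all_univalent_def by (auto dest: spec[of _ 0])
  have J0: "J z \<noteq> 0" if "z \<in> unit_disc" for z
    using Lewy_jacobian_nonzero[OF hol open_ball connected_ball that inj] by (simp add: J_def)
  have "continuous_on unit_disc J"
    unfolding J_def by (intro continuous_intros holomorphic_on_imp_continuous_on holomorphic_deriv hol open_ball)
  then have conn: "connected (J ` unit_disc)" by (intro connected_continuous_image connected_ball)
  assume "\<not> ?thesis"
  then obtain x y where "x \<in> unit_disc" "y \<in> unit_disc" "J x \<le> 0" "J y \<ge> 0"
    by (auto simp: J_def not_less)
  then have "0 \<in> J ` unit_disc" using connectedD_interval[OF conn, of "J x" "J y" 0] by blast
  then show False using J0 by auto
qed

text \<open>This pair represents \<open>(f - f(0)) / a\<close>; the outer conjugation turns the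
  factor of \<open>g\<close> into \<open>inverse (cnj a)\<close>. As \<open>S_H\<close> does not
  prescribe \<open>deriv g 0\<close>, translation and scaling suffice.\<close>

lemma E_H_normalisation:
  assumes u: "all_univalent h g" and sp: "\<forall>z\<in>unit_disc. norm (deriv g z) < norm (deriv h z)"
  defines "a \<equiv> deriv h 0"
  shows "(\<lambda>z. inverse a * (h z - h 0), \<lambda>z. inverse (cnj a) * (g z - g 0)) \<in> E_H"
proof -
  define H where "H = (\<lambda>z. inverse a * (h z - h 0))"
  define G where "G = (\<lambda>z. inverse (cnj a) * (g z - g 0))"
  have hol: "h holomorphic_on unit_disc" "g holomorphic_on unit_disc"
    and inj: "inj_on (harmonic_map ((deriv ^^ n) h) ((deriv ^^ n) g)) unit_disc" for n
    using u by (auto simp: all_univalent_def)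
  have nz: "deriv h z \<noteq> 0" if "z \<in> unit_disc" for z using sp that by fastforce
  then have a: "a \<noteq> 0" by (simp add: a_def)
  have hd: "(deriv ^^ n) (\<lambda>z. c * (f z - f 0)) z = c * ((deriv ^^ n) f z - (if n = 0 then f 0 else 0))"
    if "f holomorphic_on unit_disc" "z \<in> unit_disc" for n c f z
  proof -
    have "(deriv ^^ n) (\<lambda>z. c * (f z - f 0)) z = c * (deriv ^^ n) (\<lambda>z. f z - f 0) z"
      using that by (intro higher_deriv_cmult[of _ unit_disc] holomorphic_intros) auto
    also have "(deriv ^^ n) (\<lambda>z. f z - f 0) z = (deriv ^^ n) f z - (deriv ^^ n) (\<lambda>_. f 0) z"
      using that by (intro higher_deriv_diff[of _ unit_disc] holomorphic_intros) auto
    finally show ?thesis by simp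
  qed
  have inj': "inj_on (harmonic_map ((deriv ^^ n) H) ((deriv ^^ n) G)) unit_disc" for n
  proof (rule inj_onI)
    fix x y assume xy: "x \<in> unit_disc" "y \<in> unit_disc"
      "harmonic_map ((deriv ^^ n) H) ((deriv ^^ n) G) x = harmonic_map ((deriv ^^ n) H) ((deriv ^^ n) G) y"
    \<comment> \<open>The translation by \<open>f(0)\<close> affects only the map itself, not its
      derivatives.\<close>
    define c where "c = (if n = 0 then harmonic_map h g 0 else 0)"
    have "harmonic_map ((deriv ^^ n) H) ((deriv ^^ n) G) z =
        inverse a * (harmonic_map ((deriv ^^ n) h) ((deriv ^^ n) g) z - c)" if "z \<in> unit_disc" for z
      unfolding harmonic_map_def H_def G_def hd[OF hol(1) that] hd[OF hol(2) that] c_def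
      by (simp add: algebra_simps)
    then have "harmonic_map ((deriv ^^ n) h) ((deriv ^^ n) g) x = harmonic_map ((deriv ^^ n) h) ((deriv ^^ n) g) y"
      using xy a by simp
    then show "x = y" using inj[of n] xy unfolding inj_on_def by blast
  qed
  have dH: "deriv H z = inverse a * deriv h z" "deriv G z = inverse (cnj a) * deriv g z"
    if "z \<in> unit_disc" for z
    using hd[OF hol(1) that, of 1] hd[OF hol(2) that, of 1] by (simp_all add: H_def G_def)
  have "sense_preserving H G"
    unfolding sense_preserving_def
  proof (intro conjI exI[of _ "\<lambda>z. deriv G z / deriv H z"] ballI)
    have holHG: "H holomorphic_on unit_disc" "G holomorphic_on unit_disc"
      unfolding H_def G_def by (intro holomorphic_intros hol)+
    show "(\<lambda>z. deriv G z / deriv H z) holomorphic_on unit_disc"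
      using dH nz a by (intro holomorphic_intros holomorphic_deriv holHG) auto
    show "norm (deriv G z / deriv H z) < 1" if "z \<in> unit_disc" for z
    proof -
      have "norm (deriv G z) < norm (deriv H z)"
        unfolding dH[OF that] using sp that a by (simp add: norm_mult norm_inverse)
      moreover from this have "norm (deriv H z) > 0" by (metis norm_ge_zero order_le_less_trans)
      ultimately show ?thesis by (simp add: norm_divide)
    qed
    show "deriv G z = deriv G z / deriv H z * deriv H z" if "z \<in> unit_disc" for z
      using dH[OF that] nz[OF that] a by simp
    show "\<not> harmonic_map H G constant_on unit_disc"
    proof
      assume "harmonic_map H G constant_on unit_disc"
      then have "harmonic_map H G 0 = harmonic_map H G (1/2)" unfolding constant_on_def by fastforce
      then have "(0::complex) = 1/2" using inj_onD[OF inj'[of 0], of 0 "1/2"] by (simp add: norm_divide)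
      then show False by simp
    qed
  qed
  moreover have "H holomorphic_on unit_disc" "G holomorphic_on unit_disc"
    unfolding H_def G_def by (intro holomorphic_intros hol)+
  moreover have "taylor_coeff H 0 = 0" "taylor_coeff G 0 = 0" "taylor_coeff H 1 = 1"
    using dH[of 0] a by (simp_all add: taylor_coeff_def) (simp_all add: H_def G_def a_def)
  ultimately have "(H, G) \<in> E_H" using inj' inj'[of 0] by (simp add: E_H_def S_H_def)
  then show ?thesis by (simp add: H_def G_def)
qed

text \<open>\<open>sense_preserving\<close> alone would allow common zeros of \<open>deriv h\<close>
  and \<open>deriv g\<close>. Lewy's theorem excludes them through the dichotomy, and
  \<open>deriv h 0 = 1\<close> decides which alternative holds.\<close>

lemma E_H_D:
  assumes "(h, g) \<in> E_H"
  shows "all_univalent h g" "h 0 = 0" "g 0 = 0" "deriv h 0 = 1"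
    "z \<in> unit_disc \<Longrightarrow> norm (deriv g z) < norm (deriv h z)"
proof -
  have S: "h holomorphic_on unit_disc" "g holomorphic_on unit_disc" "inj_on (harmonic_map h g) unit_disc"
      "h 0 = 0" "g 0 = 0" "deriv h 0 = 1" "sense_preserving h g"
    using assms by (auto simp: E_H_def S_H_def taylor_coeff_def)
  show "h 0 = 0" "g 0 = 0" "deriv h 0 = 1" by fact+
  have "inj_on (harmonic_map ((deriv ^^ n) h) ((deriv ^^ n) g)) unit_disc" for n
    using assms S(3) by (cases "n = 0") (auto simp: E_H_def)
  then show u: "all_univalent h g" using S by (simp add: all_univalent_def)
  obtain \<omega> where w: "\<And>z. z \<in> unit_disc \<Longrightarrow> norm (\<omega> z) < 1 \<and> deriv g z = \<omega> z * deriv h z"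
    using S(7) unfolding sense_preserving_def by blast
  have "norm (deriv g 0) < norm (deriv h 0)" using w[of 0] S(6) by simp
  then have "\<not> (\<forall>z\<in>unit_disc. norm (deriv h z) < norm (deriv g z))"
    by (auto intro!: bexI[of _ 0])
  then have "\<forall>z\<in>unit_disc. norm (deriv g z) < norm (deriv h z)"
    using all_univalent_dichotomy[OF u] by blast
  then show "z \<in> unit_disc \<Longrightarrow> norm (deriv g z) < norm (deriv h z)" by blast
qed

text \<open>\<open>coefficient_bound\<close> applies to the first derivatives of \<open>h\<close>
  and \<open>g\<close>, and \<open>deriv h 0 = 1\<close> makes the bound uniform over the class.
  This boundedness is what turns the real suprema into upper bounds.\<close>

lemma E_H_taylor_coeff_2_bound:
  assumes "(h, g) \<in> E_H"
  shows "norm (taylor_coeff h 2) \<le> 641" "norm (taylor_coeff g 2) \<le> 641"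
proof -
  have u: "all_univalent (deriv h) (deriv g)" using E_H_D(1)[OF assms] by (rule all_univalent_deriv)
  then have "deriv h holomorphic_on unit_disc" "deriv g holomorphic_on unit_disc"
     "inj_on (harmonic_map (deriv h) (deriv g)) unit_disc"
    unfolding all_univalent_def by (auto dest: spec[of _ 0])
  then have "norm (deriv (deriv h) 0) \<le> 641 * norm (deriv h 0)" "norm (deriv (deriv g) 0) \<le> 641 * norm (deriv h 0)"
    using coefficient_bound[of "deriv h" "deriv g"] E_H_D(5)[OF assms] by blast+
  then show "norm (taylor_coeff h 2) \<le> 641" "norm (taylor_coeff g 2) \<le> 641"
    using E_H_D(4)[OF assms] by (simp_all add: taylor_coeff_def numeral_2_eq_2 norm_divide)
qed

lemma taylor_coeff_2_le_alpha0_beta0: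
  assumes "(h, g) \<in> E_H"
  shows "norm (taylor_coeff h 2) \<le> alpha0" "norm (taylor_coeff g 2) \<le> beta0"
proof -
  have "bdd_above ((\<lambda>(h, g). norm (taylor_coeff h 2)) ` E_H)"
       "bdd_above ((\<lambda>(h, g). norm (taylor_coeff g 2)) ` E_H)"
    using E_H_taylor_coeff_2_bound by (auto intro!: bdd_aboveI2[of _ _ 641])
  then show "norm (taylor_coeff h 2) \<le> alpha0" "norm (taylor_coeff g 2) \<le> beta0"
    unfolding alpha0_def beta0_def using cSUP_upper[OF assms] by fastforce+
qed

text \<open>Normalisation divides by the larger first derivative, and the factor 2 comes from
  \<open>a_2 = h''(0) / 2\<close>. If \<open>g\<close> dominates, the components are swapped first;
  the maxima on both sides make the estimate symmetric under this swap.\<close>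

lemma second_deriv_le:
  assumes u: "all_univalent h g"
  shows "max (norm (deriv (deriv h) 0)) (norm (deriv (deriv g) 0))
     \<le> 2 * max alpha0 beta0 * max (norm (deriv h 0)) (norm (deriv g 0))"
proof -
  have main: "norm (deriv (deriv h) 0) \<le> 2 * max alpha0 beta0 * norm (deriv h 0)"
      "norm (deriv (deriv g) 0) \<le> 2 * max alpha0 beta0 * norm (deriv h 0)"
    if u: "all_univalent h g" and sp: "\<forall>z\<in>unit_disc. norm (deriv g z) < norm (deriv h z)" for h g
  proof -
    have hol: "h holomorphic_on unit_disc" "g holomorphic_on unit_disc" using u by (auto simp: all_univalent_def)
    have "norm (deriv g 0) < norm (deriv h 0)" using sp by simp
    then have nz: "norm (deriv h 0) > 0" by (metis norm_ge_zero order_le_less_trans)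
    have hd: "taylor_coeff (\<lambda>z. c * (f z - f 0)) 2 = c * deriv (deriv f) 0 / 2"
      if "f holomorphic_on unit_disc" for c f
    proof -
      have "(deriv ^^ 2) (\<lambda>z. c * (f z - f 0)) 0 = c * (deriv ^^ 2) (\<lambda>z. f z - f 0) 0"
        using that by (intro higher_deriv_cmult[of _ unit_disc] holomorphic_intros) auto
      also have "(deriv ^^ 2) (\<lambda>z. f z - f 0) 0 = (deriv ^^ 2) f 0 - (deriv ^^ 2) (\<lambda>_. f 0) 0"
        using that by (intro higher_deriv_diff[of _ unit_disc] holomorphic_intros) auto
      finally show ?thesis by (simp add: taylor_coeff_def numeral_2_eq_2)
    qed
    have "norm (inverse (deriv h 0) * deriv (deriv h) 0 / 2) \<le> max alpha0 beta0"
        "norm (inverse (cnj (deriv h 0)) * deriv (deriv g) 0 / 2) \<le> max alpha0 beta0"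
      using taylor_coeff_2_le_alpha0_beta0[OF E_H_normalisation[OF u sp]]
      unfolding hd[OF hol(1)] hd[OF hol(2)] by (simp_all add: le_max_iff_disj)
    then show "norm (deriv (deriv h) 0) \<le> 2 * max alpha0 beta0 * norm (deriv h 0)"
      "norm (deriv (deriv g) 0) \<le> 2 * max alpha0 beta0 * norm (deriv h 0)"
      using nz by (simp_all add: norm_mult norm_divide norm_inverse field_simps)
  qed
  show ?thesis
    using all_univalent_dichotomy[OF u]
  proof
    assume sp: "\<forall>z\<in>unit_disc. norm (deriv g z) < norm (deriv h z)"
    then have "norm (deriv g 0) < norm (deriv h 0)" by simp
    then have "max (norm (deriv h 0)) (norm (deriv g 0)) = norm (deriv h 0)" by simp
    then show ?thesis using main[OF u sp] by simp
  next
    assume sp: "\<forall>z\<in>unit_disc. norm (deriv h z) < norm (deriv g z)"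
    then have "norm (deriv h 0) < norm (deriv g 0)" by simp
    then have "max (norm (deriv h 0)) (norm (deriv g 0)) = norm (deriv g 0)" by simp
    then show ?thesis using main[OF all_univalent_swap[OF u] sp] by simp
  qed
qed

text \<open>Lewy's theorem for the first derivative of \<open>f\<close> excludes
  \<open>h''(0) = g''(0) = 0\<close>, and \<open>second_deriv_le\<close> then forces positivity. The
  number later occurs as a denominator.\<close>

lemma max_alpha0_beta0_pos:
  assumes "(h, g) \<in> E_H"
  shows "max alpha0 beta0 > 0"
proof -
  note u = E_H_D(1)[OF assms]
  have "norm (deriv (deriv g) 0) \<noteq> norm (deriv (deriv h) 0)"
    using all_univalent_dichotomy[OF all_univalent_deriv[OF u]]
    by (elim disjE) (drule bspec[of _ _ 0], simp, simp)+
  then have "0 < max (norm (deriv (deriv h) 0)) (norm (deriv (deriv g) 0))"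
    by (cases "deriv (deriv h) 0 = 0") (simp_all add: less_max_iff_disj)
  also have "\<dots> \<le> 2 * max alpha0 beta0 * max (norm (deriv h 0)) (norm (deriv g 0))"
    by (rule second_deriv_le[OF u])
  finally have "0 < max alpha0 beta0 * max (norm (deriv h 0)) (norm (deriv g 0))" by simp
  moreover have "max (norm (deriv h 0)) (norm (deriv g 0)) \<ge> 0" by (simp add: le_max_iff_disj)
  ultimately show ?thesis by (simp add: zero_less_mult_iff)
qed

lemma E_H_higher_deriv_bound:
  assumes "(h, g) \<in> E_H"
  shows "max (norm ((deriv ^^ Suc n) h 0)) (norm ((deriv ^^ Suc n) g 0)) \<le> (2 * max alpha0 beta0) ^ n"
proof (induction n)
  case 0
  show ?case using E_H_D(4)[OF assms] E_H_D(5)[OF assms, of 0] by simp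
next
  case (Suc n)
  \<comment> \<open>The \<open>n\<close>-th derivatives again form an \<open>all_univalent\<close>
    pair, so \<open>second_deriv_le\<close> can be iterated.\<close>
  have "max (norm ((deriv ^^ Suc (Suc n)) h 0)) (norm ((deriv ^^ Suc (Suc n)) g 0))
     \<le> 2 * max alpha0 beta0 * max (norm ((deriv ^^ Suc n) h 0)) (norm ((deriv ^^ Suc n) g 0))"
    using second_deriv_le[OF all_univalent_higher_deriv[OF E_H_D(1)[OF assms], of n]]
    by (simp only: funpow.simps(2) comp_apply)
  also have "\<dots> \<le> 2 * max alpha0 beta0 * (2 * max alpha0 beta0) ^ n"
    using max_alpha0_beta0_pos[OF assms] by (intro mult_left_mono Suc) auto
  finally show ?case by simp
qed
section \<open>Growth of the entire extension\<close>

text \<open>For \<open>n \<ge> 1\<close> the \<open>n\<close>-th Taylor coefficient is at most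
  \<open>c ^ (n - 1) / fact n\<close>, so the series is dominated by that of
  \<open>(exp (c * norm z) - 1) / c\<close> and converges everywhere.\<close>

lemma entire_extension:
  fixes f :: "complex \<Rightarrow> complex" and c :: real
  assumes hol: "f holomorphic_on unit_disc" and f0: "f 0 = 0" and c: "c > 0"
    and bnd: "\<And>n. norm ((deriv ^^ Suc n) f 0) \<le> c ^ n"
  obtains F where "F holomorphic_on UNIV" "\<And>z. z \<in> unit_disc \<Longrightarrow> F z = f z"
    "\<And>z. norm (F z) \<le> (exp (c * norm z) - 1) / c"
proof -
  define a where "a = (\<lambda>n. (deriv ^^ n) f 0 / fact n)"
  \<comment> \<open>The subtracted 1 removes the \<open>n = 0\<close> term of the exponential
    series, matching \<open>a 0 = 0\<close>.\<close>
  define b where "b = (\<lambda>x n. (x ^ n /\<^sub>R fact n - (if n = 0 then 1 else 0)) / c :: real)"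
  define F where "F = (\<lambda>z. \<Sum>n. a n * z ^ n)"
  have sb: "b x sums ((exp x - 1) / c)" for x
    unfolding b_def by (intro sums_divide sums_diff exp_converges sums_single[where f = "\<lambda>_. 1"])
  have ab: "norm (a n * z ^ n) \<le> b (c * norm z) n" for n z
  proof (cases n)
    case 0
    then show ?thesis by (simp add: a_def b_def f0)
  next
    case (Suc m)
    have "norm (a n) \<le> c ^ m / fact n"
      using bnd[of m] by (simp add: a_def Suc norm_divide divide_right_mono del: funpow.simps fact_Suc)
    then have "norm (a n * z ^ n) \<le> c ^ m / fact n * norm z ^ n"
      unfolding norm_mult norm_power by (intro mult_right_mono) auto
    also have "\<dots> = b (c * norm z) n" using c by (simp add: b_def Suc power_mult_distrib field_simps del: fact_Suc)
    finally show ?thesis .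
  qed
  have summ: "summable (\<lambda>n. norm (a n * z ^ n))" for z
    by (rule summable_comparison_test'[OF sums_summable[OF sb[of "c * norm z"]], of 0]) (use ab in auto)
  have sF: "(\<lambda>n. a n * z ^ n) sums F z" for z
    unfolding F_def using summable_norm_cancel[OF summ] by (rule summable_sums)
  show thesis
  proof (rule that)
    have "F holomorphic_on ball 0 r" for r
      by (rule power_series_holomorphic[of 0 r a]) (use sF in auto)
    then have "F field_differentiable at z" for z
      using holomorphic_on_imp_differentiable_at[OF _ open_ball, of F 0 "norm z + 1" z] by simp
    then show "F holomorphic_on UNIV" by (simp add: holomorphic_on_def)
    show "F z = f z" if "z \<in> unit_disc" for z
      using holomorphic_power_series[OF hol that] sums_unique2[OF sF[of z]] by (simp add: a_def)
    show "norm (F z) \<le> (exp (c * norm z) - 1) / c" for z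
    proof -
      have "norm (F z) \<le> (\<Sum>n. norm (a n * z ^ n))" unfolding F_def by (rule summable_norm[OF summ])
      also have "\<dots> \<le> (\<Sum>n. b (c * norm z) n)" using sb by (intro suminf_le ab summ) (rule sums_summable)
      also have "\<dots> = (exp (c * norm z) - 1) / c" using sb by (rule sums_unique[symmetric])
      finally show ?thesis .
    qed
  qed
qed

text \<open>The free factors make the lemma reusable: differentiation in \<open>x\<close> keeps
  \<open>a\<close> and \<open>b\<close>, differentiation in \<open>y\<close> multiplies both by
  \<open>\<i>\<close>, so the partial derivatives have the same form again.\<close>

lemma harmonic_map_has_derivative:
  assumes "H holomorphic_on UNIV" "G holomorphic_on UNIV"
  shows "((\<lambda>z. a * H z + cnj (b * G z)) has_derivative
     (\<lambda>w. Re w *\<^sub>R (a * deriv H z + cnj (b * deriv G z)) +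
          Im w *\<^sub>R ((\<i> * a) * deriv H z + cnj ((\<i> * b) * deriv G z)))) (at z)"
proof -
  have d: "(H has_derivative (\<lambda>w. w * deriv H z)) (at z)" "(G has_derivative (\<lambda>w. w * deriv G z)) (at z)"
    using holomorphic_derivI[OF assms(1) open_UNIV, of z] holomorphic_derivI[OF assms(2) open_UNIV, of z]
    by (simp_all add: has_field_derivative_def mult_commute_abs)
  have "((\<lambda>z. a * H z + cnj (b * G z)) has_derivative
      (\<lambda>w. a * (w * deriv H z) + cnj (b * (w * deriv G z)))) (at z)"
    by (intro derivative_intros has_derivative_cnj d)
  moreover have "(\<lambda>w. a * (w * deriv H z) + cnj (b * (w * deriv G z))) =
     (\<lambda>w. Re w *\<^sub>R (a * deriv H z + cnj (b * deriv G z)) +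
          Im w *\<^sub>R ((\<i> * a) * deriv H z + cnj ((\<i> * b) * deriv G z)))"
  proof
    fix w :: complex
    have "w = of_real (Re w) + \<i> * of_real (Im w)" by (rule complex_eq)
    then have "a * (w * deriv H z) + cnj (b * (w * deriv G z)) =
      a * ((of_real (Re w) + \<i> * of_real (Im w)) * deriv H z) + cnj (b * ((of_real (Re w) + \<i> * of_real (Im w)) * deriv G z))"
      by simp
    then show "a * (w * deriv H z) + cnj (b * (w * deriv G z)) =
      Re w *\<^sub>R (a * deriv H z + cnj (b * deriv G z)) +
          Im w *\<^sub>R ((\<i> * a) * deriv H z + cnj ((\<i> * b) * deriv G z))"
      by (simp only: scaleR_conv_of_real complex_cnj_mult complex_cnj_add complex_cnj_complex_of_real algebra_simps)
  qed
  ultimately show ?thesis by simp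
qed

lemma harmonic_entire_harmonic_map:
  assumes H: "H holomorphic_on UNIV" and G: "G holomorphic_on UNIV"
  shows "harmonic_entire (harmonic_map H G)"
proof -
  have H': "deriv H holomorphic_on UNIV" and G': "deriv G holomorphic_on UNIV"
    using H G by (auto intro!: holomorphic_deriv)
  have cont: "continuous_on UNIV (deriv (deriv H))" "continuous_on UNIV (deriv (deriv G))"
    using H' G' by (auto intro!: holomorphic_on_imp_continuous_on holomorphic_deriv)
  define D where "D = (\<lambda>a b z. a * deriv (deriv H) z + cnj (b * deriv (deriv G) z))"
  have contD: "continuous_on UNIV (D a b)" for a b
    unfolding D_def by (intro continuous_intros cont)
  show ?thesis
    unfolding harmonic_entire_def harmonic_on_def
  proof (intro conjI exI ballI open_UNIV)
    \<comment> \<open>The products with \<open>1\<close> and \<open>\<i>\<close> stay unsimplified: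
      they instantiate the unknown partial derivatives in the form in which
      \<open>harmonic_map_has_derivative\<close> yields them.\<close>
    show "(harmonic_map H G has_derivative (\<lambda>w. Re w *\<^sub>R (1 * deriv H z + cnj (1 * deriv G z)) +
        Im w *\<^sub>R ((\<i> * 1) * deriv H z + cnj ((\<i> * 1) * deriv G z)))) (at z)" for z
      using harmonic_map_has_derivative[OF H G, of 1 1] by (simp add: harmonic_map_def[abs_def])
    show "((\<lambda>z. 1 * deriv H z + cnj (1 * deriv G z)) has_derivative
        (\<lambda>w. Re w *\<^sub>R D 1 1 z + Im w *\<^sub>R D (\<i> * 1) (\<i> * 1) z)) (at z)" for z
      unfolding D_def by (rule harmonic_map_has_derivative[OF H' G'])
    show "((\<lambda>z. (\<i> * 1) * deriv H z + cnj ((\<i> * 1) * deriv G z)) has_derivative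
        (\<lambda>w. Re w *\<^sub>R D (\<i> * 1) (\<i> * 1) z + Im w *\<^sub>R D (\<i> * (\<i> * 1)) (\<i> * (\<i> * 1)) z)) (at z)" for z
      unfolding D_def by (rule harmonic_map_has_derivative[OF H' G'])
    \<comment> \<open>Differentiating twice in \<open>y\<close> contributes the factor
      \<open>\<i> * \<i> = - 1\<close>.\<close>
    show "D 1 1 z + D (\<i> * (\<i> * 1)) (\<i> * (\<i> * 1)) z = 0" for z
      by (simp add: D_def)
  qed (rule contD)+
qed

text \<open>The maximum principle carries the bound from arbitrarily large circles to their
  interiors. So \<open>exp u\<close> is bounded, hence constant by Liouville, and its derivative
  \<open>exp u * u'\<close> vanishes.\<close>

lemma deriv_eq_0_of_Re_bounded_on_circles:
  assumes hol: "u holomorphic_on UNIV"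
    and bd: "\<And>R. \<exists>r>R. \<forall>z\<in>sphere 0 r. Re (u z) \<le> B"
  shows "deriv u 0 = 0"
proof -
  define e where "e = (\<lambda>z. exp (u z))"
  have hole: "e holomorphic_on UNIV" unfolding e_def by (intro holomorphic_intros hol)
  have "norm (e z) \<le> exp B" for z
  proof -
    obtain r where r: "r > norm z" "\<forall>z\<in>sphere 0 r. Re (u z) \<le> B" using bd by blast
    show ?thesis
    proof (rule maximum_modulus_frontier[where S = "cball 0 r" and f = e and \<xi> = z])
      show "norm (e w) \<le> exp B" if "w \<in> frontier (cball 0 r)" for w
        using that r(2) by (simp add: e_def)
      show "e holomorphic_on interior (cball 0 r)" using hole holomorphic_on_subset by blast
      show "continuous_on (closure (cball 0 r)) e"
        using holomorphic_on_imp_continuous_on[OF hole] continuous_on_subset by blast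
    qed (use r(1) in auto)
  qed
  then have "bounded (range e)" by (auto intro!: boundedI)
  then obtain k where k: "e = (\<lambda>_. k)"
    using Liouville_theorem[OF hole] unfolding constant_on_def by auto
  have "(e has_field_derivative exp (u 0) * deriv u 0) (at 0)"
    unfolding e_def using holomorphic_derivI[OF hol open_UNIV, of 0] by (auto intro!: derivative_eq_intros)
  moreover have "(e has_field_derivative 0) (at 0)" unfolding k by simp
  ultimately have "exp (u 0) * deriv u 0 = 0" using DERIV_unique by blast
  then show ?thesis by simp
qed

lemma norm_le_max_modulus:
  assumes "continuous_on UNIV F" "norm z = r"
  shows "norm (F z) \<le> max_modulus r F"
proof -
  have "compact ((\<lambda>z. norm (F z)) ` sphere 0 r)"
    by (intro compact_continuous_image continuous_on_norm continuous_on_subset[OF assms(1)]) auto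
  then have "bdd_above ((\<lambda>z. norm (F z)) ` sphere 0 r)"
    by (intro bounded_imp_bdd_above compact_imp_bounded)
  then show ?thesis unfolding max_modulus_def using assms(2) by (intro cSUP_upper) auto
qed

text \<open>Otherwise the map is bounded on arbitrarily large circles, and so are its real part
  \<open>Re (H + G)\<close> and its imaginary part \<open>Re (- \<i> * (H - G))\<close>. Then
  \<open>H + G\<close> and \<open>H - G\<close> both have derivative 0 at the origin, hence so does
  \<open>H\<close>.\<close>

lemma eventually_max_modulus_ge:
  assumes H: "H holomorphic_on UNIV" and G: "G holomorphic_on UNIV" and d: "deriv H 0 \<noteq> 0"
  shows "eventually (\<lambda>r. max_modulus r (harmonic_map H G) \<ge> B) at_top"
proof (rule ccontr)
  assume "\<not> ?thesis"
  then have fr: "\<exists>r>R. max_modulus r (harmonic_map H G) < B" for R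
    unfolding eventually_at_top_dense by (auto simp: not_le)
  have cont: "continuous_on UNIV (harmonic_map H G)"
    unfolding harmonic_map_def[abs_def] by (intro continuous_intros holomorphic_on_imp_continuous_on H G)
  have sm: "\<exists>r>R. \<forall>z\<in>sphere 0 r. norm (harmonic_map H G z) \<le> B" for R
    using fr[of R] norm_le_max_modulus[OF cont] by (metis dual_order.strict_trans2 less_imp_le mem_sphere_0)
  have dHG: "(H has_field_derivative deriv H 0) (at 0)" "(G has_field_derivative deriv G 0) (at 0)"
    using holomorphic_derivI[OF H open_UNIV, of 0] holomorphic_derivI[OF G open_UNIV, of 0] by auto
  have re: "Re (H z + G z) \<le> norm (harmonic_map H G z)" for z
    using complex_Re_le_cmod[of "harmonic_map H G z"] by (simp add: harmonic_map_def)
  have im: "Re (- \<i> * (H z - G z)) \<le> norm (harmonic_map H G z)" for z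
    using abs_Im_le_cmod[of "harmonic_map H G z"] by (simp add: harmonic_map_def)
  have "deriv (\<lambda>z. H z + G z) 0 = 0"
  proof (rule deriv_eq_0_of_Re_bounded_on_circles)
    show "\<exists>r>R. \<forall>z\<in>sphere 0 r. Re (H z + G z) \<le> B" for R using sm[of R] re order_trans by blast
  qed (intro holomorphic_intros H G)
  moreover have "deriv (\<lambda>z. - \<i> * (H z - G z)) 0 = 0"
  proof (rule deriv_eq_0_of_Re_bounded_on_circles)
    show "\<exists>r>R. \<forall>z\<in>sphere 0 r. Re (- \<i> * (H z - G z)) \<le> B" for R using sm[of R] im order_trans by blast
  qed (intro holomorphic_intros H G)
  moreover have "deriv (\<lambda>z. H z + G z) 0 = deriv H 0 + deriv G 0"
    "deriv (\<lambda>z. - \<i> * (H z - G z)) 0 = - \<i> * (deriv H 0 - deriv G 0)"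
    using dHG by (auto intro!: DERIV_imp_deriv derivative_eq_intros)
  ultimately have "deriv H 0 + deriv G 0 = 0" "deriv H 0 - deriv G 0 = 0" by auto
  then have "2 * deriv H 0 = 0" by (simp add: algebra_simps)
  then show False using d by simp
qed

text \<open>The lower bound makes \<open>ln (max_modulus r F)\<close> at least 1 for large
  \<open>r\<close>, so both logarithms are taken of positive numbers, where they are monotone. The
  order is at most 1 because \<open>ln \<tau> / ln r\<close> tends to 0.\<close>

lemma exponential_typeI:
  fixes \<tau> :: real
  assumes \<tau>: "\<tau> > 0" and upper: "\<And>r. r \<ge> 1 \<Longrightarrow> max_modulus r F \<le> exp (\<tau> * r)"
    and lower: "eventually (\<lambda>r. max_modulus r F \<ge> exp 1) at_top"
  shows "exponential_type F"
proof -
  have ev: "eventually (\<lambda>r. r > 1 \<and> max_modulus r F \<ge> exp 1) at_top"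
    using lower eventually_gt_at_top[of 1] by eventually_elim auto
  have ln_le: "ln (max_modulus r F) \<le> \<tau> * r" "1 \<le> ln (max_modulus r F)" if "r > 1" "max_modulus r F \<ge> exp 1" for r
  proof -
    have pos: "max_modulus r F > 0" using that(2) exp_gt_zero[of "1::real"] by linarith
    show "ln (max_modulus r F) \<le> \<tau> * r"
      using upper[of r] that pos by (metis ln_exp ln_le_cancel_iff exp_gt_zero less_imp_le)
    show "1 \<le> ln (max_modulus r F)"
      using that(2) pos by (simp add: ln_ge_iff)
  qed
  have "((\<lambda>r. ln \<tau> / ln r + 1) \<longlongrightarrow> 0 + 1) at_top"
    by (intro tendsto_intros tendsto_divide_0[OF tendsto_const] filterlim_at_top_imp_at_infinity ln_at_top)
  then have "((\<lambda>r. ereal (ln \<tau> / ln r + 1)) \<longlongrightarrow> ereal 1) at_top" by (intro tendsto_intros) simp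
  then have "Limsup at_top (\<lambda>r. ereal (ln \<tau> / ln r + 1)) = ereal 1"
    by (intro lim_imp_Limsup) auto
  moreover have "growth_order F \<le> Limsup at_top (\<lambda>r. ereal (ln \<tau> / ln r + 1))"
    unfolding growth_order_def
  proof (rule Limsup_mono, use ev in eventually_elim)
    case (elim r)
    then have "ln (ln (max_modulus r F)) \<le> ln (\<tau> * r)" using ln_le[of r] by (intro ln_mono) auto
    also have "\<dots> = ln \<tau> + ln r" using \<tau> elim by (intro ln_mult_pos) auto
    finally have "ln (ln (max_modulus r F)) / ln r \<le> (ln \<tau> + ln r) / ln r"
      using elim by (intro divide_right_mono) auto
    also have "\<dots> = ln \<tau> / ln r + 1" using elim by (simp add: add_divide_distrib)
    finally show ?case by simp
  qed
  ultimately have ord: "growth_order F \<le> 1" by (simp add: one_ereal_def)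
  \<comment> \<open>An order below 1 suffices by itself; for order 1 the exponent in
    \<open>growth_type\<close> is 1.\<close>
  have "growth_type F \<le> ereal \<tau>" if "growth_order F = 1"
    unfolding growth_type_def that
  proof (rule Limsup_bounded, use ev in eventually_elim)
    case (elim r)
    then have "ln (max_modulus r F) / r \<le> \<tau>" using ln_le[of r] by (simp add: divide_le_eq)
    then show ?case using elim by simp
  qed
  then show ?thesis using ord unfolding exponential_type_def by (metis order_le_less)
qed

theorem theorem4:
  fixes h g :: "complex \<Rightarrow> complex" and \<gamma> :: real
  assumes "(h, g) \<in> E_H"
  defines "\<gamma> \<equiv> max alpha0 beta0"
  shows "\<exists>F. (\<forall>z\<in>unit_disc. F z = harmonic_map h g z) \<and>
             harmonic_entire F \<and> exponential_type F \<and>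
             (\<forall>r>0. max_modulus r F \<le> (exp (2 * \<gamma> * r) - 1) / \<gamma>)"
proof -
  have \<gamma>: "\<gamma> > 0" unfolding \<gamma>_def by (rule max_alpha0_beta0_pos[OF assms(1)])
  have hol: "h holomorphic_on unit_disc" "g holomorphic_on unit_disc"
    using E_H_D(1)[OF assms(1)] by (auto simp: all_univalent_def)
  have bnd: "norm ((deriv ^^ Suc n) h 0) \<le> (2 * \<gamma>) ^ n" "norm ((deriv ^^ Suc n) g 0) \<le> (2 * \<gamma>) ^ n" for n
    using E_H_higher_deriv_bound[OF assms(1), of n] unfolding \<gamma>_def by (simp_all only: max.bounded_iff)
  \<comment> \<open>With \<open>c = 2 * \<gamma>\<close> each of the two components contributes half
    of the final bound.\<close>
  obtain H where H: "H holomorphic_on UNIV" "\<And>z. z \<in> unit_disc \<Longrightarrow> H z = h z"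
      "\<And>z. norm (H z) \<le> (exp (2 * \<gamma> * norm z) - 1) / (2 * \<gamma>)"
    by (rule entire_extension[OF hol(1) E_H_D(2)[OF assms(1)] _ bnd(1)]) (use \<gamma> in auto)
  obtain G where G: "G holomorphic_on UNIV" "\<And>z. z \<in> unit_disc \<Longrightarrow> G z = g z"
      "\<And>z. norm (G z) \<le> (exp (2 * \<gamma> * norm z) - 1) / (2 * \<gamma>)"
    by (rule entire_extension[OF hol(2) E_H_D(3)[OF assms(1)] _ bnd(2)]) (use \<gamma> in auto)
  \<comment> \<open>The normalisation of \<open>h\<close> passes to \<open>H\<close>; this supplies
    the nonzero derivative behind the lower bound for the maximum modulus.\<close>
  have "deriv H 0 = deriv h 0"
    using H(2) holomorphic_on_subset[OF H(1)]
    by (intro complex_derivative_transform_within_open[of _ unit_disc] hol) auto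
  then have dH: "deriv H 0 \<noteq> 0" using E_H_D(4)[OF assms(1)] by simp
  define F where "F = harmonic_map H G"
  have F_le: "norm (F z) \<le> (exp (2 * \<gamma> * norm z) - 1) / \<gamma>" for z
  proof -
    have "norm (F z) \<le> norm (H z) + norm (G z)"
      unfolding F_def harmonic_map_def by (metis norm_triangle_ineq complex_mod_cnj)
    also have "\<dots> \<le> (exp (2 * \<gamma> * norm z) - 1) / (2 * \<gamma>) + (exp (2 * \<gamma> * norm z) - 1) / (2 * \<gamma>)"
      by (intro add_mono H G)
    also have "\<dots> = (exp (2 * \<gamma> * norm z) - 1) / \<gamma>" using \<gamma> by (simp add: field_simps)
    finally show ?thesis .
  qed
  have M_le: "max_modulus r F \<le> (exp (2 * \<gamma> * r) - 1) / \<gamma>" if "r > 0" for r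
    unfolding max_modulus_def
  proof (rule cSUP_least)
    show "sphere (0::complex) r \<noteq> {}" using that by simp
    show "norm (F z) \<le> (exp (2 * \<gamma> * r) - 1) / \<gamma>" if "z \<in> sphere 0 r" for z
      using F_le[of z] that by simp
  qed
  have "exponential_type F"
  proof (rule exponential_typeI)
    \<comment> \<open>The factor \<open>1 / \<gamma> = exp (- ln \<gamma>)\<close> is absorbed into
      the exponent for \<open>r \<ge> 1\<close>; the absolute value covers both signs of
      \<open>ln \<gamma>\<close>.\<close>
    show "2 * \<gamma> + \<bar>ln \<gamma>\<bar> > 0" using \<gamma> by simp
    show "eventually (\<lambda>r. max_modulus r F \<ge> exp 1) at_top"
      unfolding F_def by (rule eventually_max_modulus_ge[OF H(1) G(1) dH])
    show "max_modulus r F \<le> exp ((2 * \<gamma> + \<bar>ln \<gamma>\<bar>) * r)" if "r \<ge> 1" for r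
    proof -
      have "max_modulus r F \<le> (exp (2 * \<gamma> * r) - 1) / \<gamma>" using that by (intro M_le) simp
      also have "\<dots> \<le> exp (2 * \<gamma> * r) / \<gamma>" using \<gamma> by (simp add: divide_right_mono)
      also have "\<dots> = exp (2 * \<gamma> * r - ln \<gamma>)" using \<gamma> by (simp add: exp_diff)
      also have "\<dots> \<le> exp ((2 * \<gamma> + \<bar>ln \<gamma>\<bar>) * r)"
      proof -
        have "\<bar>ln \<gamma>\<bar> * 1 \<le> \<bar>ln \<gamma>\<bar> * r" using that by (intro mult_left_mono) auto
        then show ?thesis unfolding exp_le_cancel_iff distrib_right by linarith
      qed
      finally show ?thesis .
    qed
  qed
  moreover have "F z = harmonic_map h g z" if "z \<in> unit_disc" for z
    using H(2)[OF that] G(2)[OF that] by (simp add: F_def harmonic_map_def)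
  moreover have "harmonic_entire F" unfolding F_def by (rule harmonic_entire_harmonic_map[OF H(1) G(1)])
  ultimately show ?thesis using M_le by blast
qed

end
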